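(* Let $m\ge2$, $d\ge2$, and suppose that $\alpha_v^{ij}$, $v\in[d]$, $i,j\in[m]$, are real numbers satisfying $\alpha_v^{ij}=\alpha_v^{ji}$ and $$\alpha_v^{ii}=0\quad\text{and}\quad\sum_{u=1}^d\sum_{\substack{j=1\\ j\ne i}}^m|\alpha_u^{ij}|<4\quad\text{for each }(v,i)\in[d]\times[m].$$ Then the vector field $F(x)=-x+\pi(x)$ on $\mathfrak{D}$ has a unique equilibrium point, and the process of vertex occupation measures $X=\{X(n)\}_{n\ge0}$ of the $m$ interacting walks on $[d]$ with parameters $\alpha_v^{ij}$ converges almost surely to this unique equilibrium point of $F$.
   Context: Notation: $[n]=\{1,\dots,n\}$. $\triangle=\{x\in\mathbb{R}^d:x_v\ge0,\ \sum_vx_v=1\}$, $\mathfrak{D}=\triangle^m\subset\mathbb{R}^{dm}$, points $x=(x_v^i)_{i\in[m],v\in[d]}$. The map $\pi=(\pi_v^i):\mathfrak{D}\to\mathfrak{D}$ is $$\pi_v^i(x)=\frac{\exp\big(\sum_{j=1}^m\alpha_v^{ij}x_v^j\big)}{\sum_{u=1}^d\exp\big(\sum_{j=1}^m\alpha_u^{ij}x_u^j\big)}$$ (the same formula defines $\pi$ on $\mathbb{R}^{dm}$). An equilibrium point of $F$ is an $x\in\mathfrak{D}$ with $F(x)=0$. The process: $W(n)=(W^1(n),\dots,W^m(n))$, $n\ge1$, takes values in $[d]^m$ ($m$ walks on the complete graph with vertex set $[d]$). Set $X_v^i(0)=1$ and, for $n\ge1$, $X_v^i(n)=\frac{1}{d+n}\big(1+\sum_{k=1}^n\mathbf{1}\{W^i(k)=v\}\big)$.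 Let $\mathfrak{F}_0$ be the trivial $\sigma$-algebra and $\mathfrak{F}_n=\sigma(W(k):1\le k\le n)$. For all $n\ge0$, $i\in[m]$, $v\in[d]$, $\mathbb{P}(W^i(n+1)=v\mid\mathfrak{F}_n)=\pi_v^i(X(n))$, and $W^1(n+1),\dots,W^m(n+1)$ are conditionally independent given $\mathfrak{F}_n$. $X(n)=(X_v^i(n))_{i,v}$. *)

theory Defs
  imports "HOL-Probability.Probability"
begin

text \<open>
  The index sets \<open>[m]\<close> (walks) and \<open>[d]\<close> (vertices) are finite types \<open>'m\<close> and \<open>'d\<close>.
  A point \<open>x\<close> has components \<open>x $ i $ v\<close> for the walk \<open>i\<close> and the vertex \<open>v\<close>, and
  \<open>\<alpha> v i j\<close> is the parameter with lower index \<open>v\<close> and upper indices \<open>i j\<close>.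
\<close>

definition prob_simplex :: "(real ^ 'd::finite) set" where
  "prob_simplex = {x. (\<forall>v. x $ v \<ge> 0) \<and> (\<Sum>v\<in>UNIV. x $ v) = 1}"

definition simplex_product :: "(real ^ 'd::finite ^ 'm::finite) set" where
  "simplex_product = {x. \<forall>i. x $ i \<in> prob_simplex}"

definition transition_map ::
    "('d::finite \<Rightarrow> 'm::finite \<Rightarrow> 'm \<Rightarrow> real) \<Rightarrow> real ^ 'd ^ 'm \<Rightarrow> real ^ 'd ^ 'm" where
  "transition_map \<alpha> x =
     (\<chi> i v. exp (\<Sum>j\<in>UNIV. \<alpha> v i j * x $ j $ v) /
             (\<Sum>u\<in>UNIV. exp (\<Sum>j\<in>UNIV. \<alpha> u i j * x $ j $ u)))"

definition vector_field ::
    "('d::finite \<Rightarrow> 'm::finite \<Rightarrow> 'm \<Rightarrow> real) \<Rightarrow> real ^ 'd ^ 'm \<Rightarrow> real ^ 'd ^ 'm" where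
  "vector_field \<alpha> x = - x + transition_map \<alpha> x"

definition equilibrium_point ::
    "(real ^ 'd::finite ^ 'm::finite \<Rightarrow> real ^ 'd ^ 'm) \<Rightarrow> real ^ 'd ^ 'm \<Rightarrow> bool" where
  "equilibrium_point F x \<longleftrightarrow> x \<in> simplex_product \<and> F x = 0"

text \<open>
  The value at time \<open>0\<close> is a separate convention (all components are \<open>1\<close>, so it lies outside
  the product of simplices); it is not the case \<open>n = 0\<close> of the formula used for \<open>n \<ge> 1\<close>.
\<close>

definition occupation_measure ::
    "(nat \<Rightarrow> 'a \<Rightarrow> 'd::finite ^ 'm::finite) \<Rightarrow> nat \<Rightarrow> 'a \<Rightarrow> real ^ 'd ^ 'm" where
  "occupation_measure W n \<omega> =
     (if n = 0 then (\<chi> i v. 1)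
      else (\<chi> i v. (1 + (\<Sum>k=1..n. of_bool (W k \<omega> $ i = v))) / (real CARD('d) + real n)))"

text \<open>For \<open>n = 0\<close> the generating family is empty and the \<open>\<sigma>\<close>-algebra is trivial.\<close>

definition walk_history ::
    "'a measure \<Rightarrow> (nat \<Rightarrow> 'a \<Rightarrow> 'd::finite ^ 'm::finite) \<Rightarrow> nat \<Rightarrow> 'a measure" where
  "walk_history M W n =
     sigma (space M) {W k -` A \<inter> space M | k A. 1 \<le> k \<and> k \<le> n}"

definition cond_prob_given :: "'a measure \<Rightarrow> 'a measure \<Rightarrow> 'a set \<Rightarrow> 'a \<Rightarrow> real" where
  "cond_prob_given M G E = real_cond_exp M G (indicator E)"

definition cond_indep_vars ::
    "'a measure \<Rightarrow> 'a measure \<Rightarrow> ('i \<Rightarrow> 'b measure) \<Rightarrow> ('i \<Rightarrow> 'a \<Rightarrow> 'b) \<Rightarrow> 'i set \<Rightarrow> bool" where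
  "cond_indep_vars M G N Y I \<longleftrightarrow>
     (\<forall>i\<in>I. Y i \<in> measurable M (N i)) \<and>
     (\<forall>J\<subseteq>I. J \<noteq> {} \<longrightarrow> finite J \<longrightarrow>
       (\<forall>A\<in>Pi J (\<lambda>j. sets (N j)). AE \<omega> in M.
          cond_prob_given M G {\<omega>' \<in> space M. \<forall>j\<in>J. Y j \<omega>' \<in> A j} \<omega> =
          (\<Prod>j\<in>J. cond_prob_given M G {\<omega>' \<in> space M. Y j \<omega>' \<in> A j} \<omega>)))"

text \<open>The walks start at time \<open>1\<close>; the value \<open>W 0\<close> is never used.\<close>

locale interacting_walks = prob_space M
  for M :: "'a measure"
    and \<alpha> :: "'d::finite \<Rightarrow> 'm::finite \<Rightarrow> 'm \<Rightarrow> real"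
    and W :: "nat \<Rightarrow> 'a \<Rightarrow> 'd ^ 'm" +
  assumes W_measurable: "n \<ge> 1 \<Longrightarrow> W n \<in> measurable M (count_space UNIV)"
    and W_transition: "AE \<omega> in M.
      cond_prob_given M (walk_history M W n) {\<omega>' \<in> space M. W (n + 1) \<omega>' $ i = v} \<omega> =
      transition_map \<alpha> (occupation_measure W n \<omega>) $ i $ v"
    and W_cond_indep:
      "cond_indep_vars M (walk_history M W n) (\<lambda>_. count_space UNIV)
         (\<lambda>i \<omega>. W (n + 1) \<omega> $ i) UNIV"

end

theory Submission
  imports Defs "HOL-Library.Discrete_Functions"
begin

text \<open>
  The whole theorem rests on one observation: the hypothesis on the parameters makes \<open>\<pi>\<close> a strict
  contraction for the sup norm on \<open>real ^ 'd ^ 'm\<close>. Each partial derivative of a softmax has the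
  form \<open>p v * (\<delta> - p u)\<close> with \<open>p\<close> a probability vector, so it is at most \<open>1/4\<close> in absolute value;
  by the chain rule, \<open>\<pi> $ i $ v\<close> has Lipschitz constant
  \<open>(\<Sum>u. \<Sum>j. \<bar>\<alpha> u i j\<bar>) / 4 < 1\<close> (\<open>transition_map_contraction\<close>). Uniqueness of the
  equilibrium is immediate, and its existence is Brouwer's fixed point theorem on the product of
  simplices.

  For the convergence, let \<open>x\<close> be the fixed point. By definition \<open>X n\<close> is, up to the initial weight,
  the average of the indicators of the visited vertices. Subtracting from the indicator at time
  \<open>k + 1\<close> its conditional expectation \<open>\<pi> (X k)\<close> gives (\<open>occupation_measure_decomposition\<close>)

  \<open>X n - x = (average of martingale differences) + (1 / (d + n)) * (\<Sum>k<n. \<pi> (X k) - \<pi> x) + O(1 / n)\<close>.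

  The differences are bounded and pairwise orthogonal, so their averages vanish almost surely
  (\<open>strong_law_bounded_orthogonal\<close>). Hence, with \<open>a n\<close> the sup norm of \<open>X n - x\<close> and \<open>c < 1\<close> the
  contraction constant, \<open>a n \<le> o(1) + c * (average of a over k < n)\<close>. As the upper limit of the
  averages is at most that of the sequence, \<open>limsup a \<le> c * limsup a\<close>, so \<open>a \<longlonglongrightarrow> 0\<close>
  (\<open>tendsto_zero_if_le_contracted_average\<close>).
\<close>

section \<open>The softmax function\<close>

definition softmax :: "('d::finite \<Rightarrow> real) \<Rightarrow> 'd \<Rightarrow> real" where
  "softmax y v = exp (y v) / (\<Sum>u\<in>UNIV. exp (y u))"

lemma sum_exp_pos: "(\<Sum>u\<in>UNIV. exp (y u :: real)) > 0" for y :: "'d::finite \<Rightarrow> real"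
  by (intro sum_pos) auto

lemma softmax_pos: "softmax y v > 0"
  unfolding softmax_def by (intro divide_pos_pos sum_exp_pos) simp

lemma sum_softmax: "(\<Sum>v\<in>UNIV. softmax y v) = 1"
  unfolding softmax_def sum_divide_distrib[symmetric]
  using sum_exp_pos[of y] by simp

lemma softmax_le_1: "softmax y v \<le> 1"
  using member_le_sum[of v UNIV "softmax y"] by (simp add: sum_softmax less_imp_le[OF softmax_pos])

text \<open>
  The expression is the partial derivative of \<open>softmax y v\<close> in the direction \<open>u\<close>. It is \<open>p * (1 - p)\<close>
  on the diagonal and \<open>- p * q\<close> with \<open>p + q \<le> 1\<close> off it. This bound is the source of the constant
  \<open>4\<close> in the hypothesis of the theorem.
\<close>

lemma softmax_jacobian_le:
  "\<bar>softmax y v * (of_bool (u = v) - softmax y u)\<bar> \<le> 1/4"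
proof (cases "u = v")
  case True
  have "0 \<le> (softmax y v - 1/2)\<^sup>2" by simp
  then have "softmax y v * (1 - softmax y v) \<le> 1/4"
    by (simp add: power2_eq_square algebra_simps)
  moreover have "0 \<le> softmax y v * (1 - softmax y v)"
    using softmax_pos[of y v] softmax_le_1[of y v] by simp
  ultimately show ?thesis using True by simp
next
  case False
  have "softmax y v + softmax y u = sum (softmax y) {u, v}" using False by simp
  also have "\<dots> \<le> sum (softmax y) UNIV"
    by (intro sum_mono2) (auto simp: less_imp_le[OF softmax_pos])
  finally have le: "softmax y v + softmax y u \<le> 1" by (simp add: sum_softmax)
  have "softmax y v * softmax y u \<le> softmax y v * (1 - softmax y v)"
    using le softmax_pos[of y v] by (intro mult_left_mono) auto
  also have "\<dots> \<le> 1/4"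
    using zero_le_power2[of "softmax y v - 1/2"] by (simp add: power2_eq_square algebra_simps)
  finally show ?thesis
    using False softmax_pos[of y v] softmax_pos[of y u] by (simp add: abs_mult)
qed

lemma softmax_has_derivative_along_line:
  fixes z h :: "'d::finite \<Rightarrow> real"
  defines "y \<equiv> \<lambda>t u. z u + t * h u"
  shows "((\<lambda>t. softmax (y t) v) has_real_derivative
           (\<Sum>u\<in>UNIV. h u * (softmax (y t) v * (of_bool (u = v) - softmax (y t) u)))) (at t)"
proof -
  define Z where "Z = (\<lambda>t. \<Sum>u\<in>UNIV. exp (y t u))"
  have Z: "Z t > 0" for t unfolding Z_def by (rule sum_exp_pos)
  have dZ: "(Z has_real_derivative (\<Sum>u\<in>UNIV. h u * exp (y t u))) (at t)"
    unfolding Z_def y_def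
    by (intro DERIV_sum) (auto intro!: derivative_eq_intros)
  have dE: "((\<lambda>t. exp (y t v)) has_real_derivative h v * exp (y t v)) (at t)"
    unfolding y_def by (auto intro!: derivative_eq_intros)
  have "((\<lambda>t. exp (y t v) / Z t) has_real_derivative
      (h v * exp (y t v) * Z t - exp (y t v) * (\<Sum>u\<in>UNIV. h u * exp (y t u))) / (Z t * Z t)) (at t)"
    using DERIV_divide[OF dE dZ] Z[of t] by simp
  moreover have "(h v * exp (y t v) * Z t - exp (y t v) * (\<Sum>u\<in>UNIV. h u * exp (y t u))) / (Z t * Z t)
      = softmax (y t) v * (h v - (\<Sum>u\<in>UNIV. h u * softmax (y t) u))"
  proof -
    have softmax_eq: "softmax (y t) u = exp (y t u) / Z t" for u by (simp add: softmax_def Z_def)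
    have "(\<Sum>u\<in>UNIV. h u * (exp (y t u) / Z t)) = (\<Sum>u\<in>UNIV. h u * exp (y t u)) / Z t"
      by (simp add: sum_divide_distrib)
    then show ?thesis using Z[of t] unfolding softmax_eq by (simp add: field_simps)
  qed
  moreover have "(\<Sum>u\<in>UNIV. h u * (softmax (y t) v * (of_bool (u = v) - softmax (y t) u)))
      = softmax (y t) v * (h v - (\<Sum>u\<in>UNIV. h u * softmax (y t) u))"
  proof -
    have "h u * (softmax (y t) v * (of_bool (u = v) - softmax (y t) u))
        = (if u = v then h v * softmax (y t) v else 0) - softmax (y t) v * (h u * softmax (y t) u)" for u
      by (simp add: algebra_simps)
    then show ?thesis by (simp only: sum_subtractf sum_distrib_left[symmetric]) (simp add: algebra_simps)
  qed
  ultimately show ?thesis unfolding softmax_def Z_def by simp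
qed

text \<open>
  The mean value theorem along the segment from \<open>z\<close> to \<open>y\<close>, where every partial derivative is at
  most \<open>1/4\<close>.
\<close>

lemma softmax_lipschitz:
  "\<bar>softmax y v - softmax z v\<bar> \<le> (\<Sum>u\<in>UNIV. \<bar>y u - z u\<bar>) / 4"
proof -
  define h where "h u = y u - z u" for u
  define p where "p = (\<lambda>t. softmax (\<lambda>u. z u + t * h u))"
  define p' where "p' = (\<lambda>t. \<Sum>u\<in>UNIV. h u * (p t v * (of_bool (u = v) - p t u)))"
  have "\<exists>t. 0 < t \<and> t < 1 \<and> p 1 v - p 0 v = (1 - 0) * p' t"
    using softmax_has_derivative_along_line[of z h v] unfolding p_def p'_def
    by (intro MVT2) auto
  then obtain t where "p 1 v - p 0 v = p' t" by auto
  moreover have "p 1 = softmax y" "p 0 = softmax z" unfolding p_def h_def by simp_all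
  moreover have "\<bar>p' t\<bar> \<le> (\<Sum>u\<in>UNIV. \<bar>h u\<bar> * (1/4))"
  proof -
    have "\<bar>h u * (p t v * (of_bool (u = v) - p t u))\<bar> \<le> \<bar>h u\<bar> * (1/4)" for u
      unfolding abs_mult[of "h u"] p_def by (intro mult_left_mono softmax_jacobian_le) simp
    then show ?thesis unfolding p'_def by (intro order_trans[OF sum_abs] sum_mono) auto
  qed
  ultimately show ?thesis by (simp add: h_def sum_divide_distrib)
qed

section \<open>Contraction in the sup norm and the fixed point\<close>

lemma abs_component_le_infnorm: "\<bar>x $ i $ v\<bar> \<le> infnorm x"
  for x :: "real ^ 'd::finite ^ 'm::finite"
  using Basis_le_infnorm[of "axis i (axis v 1)" x] by (simp add: inner_axis)

lemma infnorm_le_iff_components: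
  "infnorm x \<le> B \<longleftrightarrow> (\<forall>i v. \<bar>x $ i $ v\<bar> \<le> B)"
  for x :: "real ^ 'd::finite ^ 'm::finite"
proof
  assume "\<forall>i v. \<bar>x $ i $ v\<bar> \<le> B"
  then show "infnorm x \<le> B"
    unfolding infnorm_Max by (auto simp: Basis_vec_def inner_axis)
qed (meson abs_component_le_infnorm order_trans)

lemma infnorm_sum_le: "infnorm (\<Sum>k\<in>A. f k) \<le> (\<Sum>k\<in>A. infnorm (f k))"
  by (induction A rule: infinite_finite_induct)
     (auto simp: infnorm_0 intro: order_trans[OF infnorm_triangle])

lemma transition_map_softmax:
  "transition_map \<alpha> x $ i $ v = softmax (\<lambda>u. \<Sum>j\<in>UNIV. \<alpha> u i j * x $ j $ u) v"
  by (simp add: transition_map_def softmax_def)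

lemma transition_map_in_simplex_product: "transition_map \<alpha> x \<in> simplex_product"
  by (simp add: simplex_product_def prob_simplex_def transition_map_softmax sum_softmax
      less_imp_le[OF softmax_pos])

text \<open>
  The input to coordinate \<open>u\<close> of the softmax moves by at most
  \<open>(\<Sum>j. \<bar>\<alpha> u i j\<bar>) * infnorm (x - y)\<close>. The choice of the sup norm on the
  domain is what makes these row sums of absolute values appear.
\<close>

lemma transition_map_lipschitz_component:
  "\<bar>transition_map \<alpha> x $ i $ v - transition_map \<alpha> y $ i $ v\<bar>
     \<le> (\<Sum>u\<in>UNIV. \<Sum>j\<in>UNIV. \<bar>\<alpha> u i j\<bar>) / 4 * infnorm (x - y)"
proof -
  have "\<bar>(\<Sum>j\<in>UNIV. \<alpha> u i j * x $ j $ u) - (\<Sum>j\<in>UNIV. \<alpha> u i j * y $ j $ u)\<bar>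
      \<le> (\<Sum>j\<in>UNIV. \<bar>\<alpha> u i j\<bar>) * infnorm (x - y)" for u
  proof -
    have "\<bar>\<Sum>j\<in>UNIV. \<alpha> u i j * (x - y) $ j $ u\<bar> \<le> (\<Sum>j\<in>UNIV. \<bar>\<alpha> u i j\<bar> * infnorm (x - y))"
      by (intro order_trans[OF sum_abs] sum_mono)
         (auto simp: abs_mult simp del: vector_minus_component
           intro!: mult_left_mono abs_component_le_infnorm)
    then show ?thesis by (simp add: sum_subtractf[symmetric] algebra_simps sum_distrib_left)
  qed
  then have "(\<Sum>u\<in>UNIV. \<bar>(\<Sum>j\<in>UNIV. \<alpha> u i j * x $ j $ u) - (\<Sum>j\<in>UNIV. \<alpha> u i j * y $ j $ u)\<bar>)
      \<le> (\<Sum>u\<in>UNIV. (\<Sum>j\<in>UNIV. \<bar>\<alpha> u i j\<bar>) * infnorm (x - y))"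
    by (intro sum_mono)
  also have "\<dots> = (\<Sum>u\<in>UNIV. \<Sum>j\<in>UNIV. \<bar>\<alpha> u i j\<bar>) * infnorm (x - y)"
    by (rule sum_distrib_right[symmetric])
  finally show ?thesis
    unfolding transition_map_softmax
    using softmax_lipschitz[of "\<lambda>u. \<Sum>j\<in>UNIV. \<alpha> u i j * x $ j $ u" v
        "\<lambda>u. \<Sum>j\<in>UNIV. \<alpha> u i j * y $ j $ u"]
    by linarith
qed

lemma transition_map_contraction:
  fixes \<alpha> :: "'d::finite \<Rightarrow> 'm::finite \<Rightarrow> 'm \<Rightarrow> real"
  assumes "\<And>i. (\<Sum>u\<in>UNIV. \<Sum>j\<in>UNIV. \<bar>\<alpha> u i j\<bar>) < 4"
  obtains c where "0 \<le> c" "c < 1"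
    "\<And>x y. infnorm (transition_map \<alpha> x - transition_map \<alpha> y) \<le> c * infnorm (x - y)"
proof -
  define s where "s i = (\<Sum>u\<in>UNIV. \<Sum>j\<in>UNIV. \<bar>\<alpha> u i j\<bar>) / 4" for i
  have s: "0 \<le> s i" "s i < 1" for i
    using assms[of i] by (auto simp: s_def intro!: sum_nonneg)
  define c where "c = Max (range s)"
  have c: "s i \<le> c" for i unfolding c_def by (intro Max_ge) auto
  show thesis
  proof
    show "0 \<le> c" using s(1) c order_trans by blast
    show "c < 1" using s(2) unfolding c_def by (subst Max_less_iff) auto
    fix x y
    have "\<bar>(transition_map \<alpha> x - transition_map \<alpha> y) $ i $ v\<bar> \<le> c * infnorm (x - y)" for i v
      using transition_map_lipschitz_component[of \<alpha> x i v y]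
        mult_right_mono[OF c[of i] infnorm_pos_le[of "x - y"]]
      by (simp add: s_def)
    then show "infnorm (transition_map \<alpha> x - transition_map \<alpha> y) \<le> c * infnorm (x - y)"
      by (simp add: infnorm_le_iff_components)
  qed
qed

lemma convex_prob_simplex: "convex (prob_simplex :: (real ^ 'd::finite) set)"
  by (auto simp: convex_def prob_simplex_def sum.distrib sum_distrib_left[symmetric])

lemma convex_simplex_product: "convex (simplex_product :: (real ^ 'd::finite ^ 'm::finite) set)"
  using convex_prob_simplex by (auto simp: convex_def simplex_product_def)

lemma compact_simplex_product: "compact (simplex_product :: (real ^ 'd::finite ^ 'm::finite) set)"
proof -
  have "closed (simplex_product :: (real ^ 'd ^ 'm) set)"
    unfolding simplex_product_def prob_simplex_def
    by (simp add: closed_Collect_all closed_Collect_conj closed_Collect_le closed_Collect_eq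
        continuous_intros)
  moreover have "norm x \<le> (\<Sum>i\<in>(UNIV::'m set). 1)" if x: "x \<in> simplex_product" for x :: "real ^ 'd ^ 'm"
  proof -
    have "norm (x $ i) \<le> 1" for i
      using norm_le_l1_cart[of "x $ i"] x by (simp add: simplex_product_def prob_simplex_def)
    then have "(\<Sum>i\<in>UNIV. norm (x $ i)) \<le> (\<Sum>i\<in>(UNIV::'m set). 1)" by (intro sum_mono)
    moreover have "norm x \<le> (\<Sum>i\<in>UNIV. norm (x $ i))"
      unfolding norm_vec_def[of x] by (rule L2_set_le_sum) simp
    ultimately show ?thesis by linarith
  qed
  ultimately show ?thesis
    unfolding compact_eq_bounded_closed bounded_iff by blast
qed

lemma continuous_on_transition_map: "continuous_on A (transition_map \<alpha>)"
  unfolding transition_map_def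
  by (intro continuous_intros continuous_on_vec_lambda) (simp add: sum_exp_pos[THEN less_imp_neq, symmetric])

text \<open>
  The range of \<open>transition_map \<alpha>\<close> lies in \<open>simplex_product\<close>, so a fixed point in the whole space
  is one in the product of simplices.
\<close>

lemma equilibrium_point_vector_field_iff:
  "equilibrium_point (vector_field \<alpha>) x \<longleftrightarrow> transition_map \<alpha> x = x"
  unfolding equilibrium_point_def vector_field_def
  using transition_map_in_simplex_product[of \<alpha> x] by (auto simp: add_eq_0_iff)

lemma transition_map_has_fixed_point: "\<exists>x. transition_map \<alpha> x = x"
proof -
  have "simplex_product \<noteq> {}" using transition_map_in_simplex_product by blast
  then show ?thesis
    using brouwer[OF compact_simplex_product convex_simplex_product _ continuous_on_transition_map]
      transition_map_in_simplex_product by (metis Pi_I)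
qed

section \<open>Two deterministic convergence criteria\<close>

text \<open>
  The averages of a sequence have at most the upper limit of the sequence, so the upper limit \<open>L\<close> of \<open>a\<close>
  satisfies \<open>L \<le> c * L\<close>. The proof avoids upper limits: for any \<open>q\<close> between \<open>c\<close> and \<open>1\<close>, an
  eventual bound \<open>C\<close> on \<open>a\<close> improves to the eventual bound \<open>q * C\<close>, and this step is iterated.
\<close>

lemma tendsto_zero_if_le_contracted_average:
  fixes a b :: "nat \<Rightarrow> real"
  assumes nonneg: "\<And>n. 0 \<le> a n" and bound: "\<And>n. a n \<le> B"
    and b: "b \<longlonglongrightarrow> 0" and c: "0 \<le> c" "c < 1"
    and le: "\<And>n. n \<ge> 1 \<Longrightarrow> a n \<le> b n + c * ((\<Sum>k<n. a k) / n)"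
  shows "a \<longlonglongrightarrow> 0"
proof -
  define q where "q = (1 + c) / 2"
  have q: "c < q" "0 \<le> q" "q < 1" using c by (auto simp: q_def)
  have step: "\<forall>\<^sub>F n in sequentially. a n \<le> q * C" if C: "C > 0" "\<forall>\<^sub>F n in sequentially. a n \<le> C" for C
  proof -
    obtain N where N: "\<And>n. n \<ge> N \<Longrightarrow> a n \<le> C" using C(2) by (auto simp: eventually_sequentially)
    define K where "K = (\<Sum>k<N. a k)"
    have avg: "a n \<le> b n + c * (K / n) + c * C" if n: "n \<ge> 1" "n \<ge> N" for n
    proof -
      have "(\<Sum>k<n. a k) = K + (\<Sum>k=N..<n. a k)"
        unfolding K_def using n sum.atLeastLessThan_concat[of 0 N n a] by (simp add: lessThan_atLeast0)
      also have "(\<Sum>k=N..<n. a k) \<le> real (n - N) * C"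
        using sum_bounded_above[of "{N..<n}" a C] N by simp
      also have "real (n - N) * C \<le> n * C" using C by (intro mult_right_mono) auto
      finally have "(\<Sum>k<n. a k) / n \<le> K / n + C" using n by (simp add: field_simps)
      then have "c * ((\<Sum>k<n. a k) / n) \<le> c * (K / n + C)" using c by (intro mult_left_mono)
      then show ?thesis using le[OF n(1)] by (simp add: algebra_simps)
    qed
    have "(\<lambda>n. b n + c * (K / n)) \<longlonglongrightarrow> 0 + c * 0"
      by (intro tendsto_intros b lim_const_over_n)
    then have "\<forall>\<^sub>F n in sequentially. b n + c * (K / n) < (q - c) * C"
      using C q by (intro order_tendstoD(2)[of _ "0 + c * 0"]) auto
    then show ?thesis
      using eventually_ge_at_top[of 1] eventually_ge_at_top[of N]
    proof eventually_elim
      case (elim n)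
      then show ?case using avg[of n] by (simp add: algebra_simps)
    qed
  qed
  define C where "C = \<bar>B\<bar> + 1"
  have "C > 0" unfolding C_def by simp
  have q_pos: "q > 0" using c by (simp add: q_def)
  have iter: "\<forall>\<^sub>F n in sequentially. a n \<le> q ^ j * C" for j
  proof (induction j)
    case 0
    have "a n \<le> C" for n using bound[of n] unfolding C_def by linarith
    then show ?case by simp
  next
    case (Suc j)
    then show ?case using step[of "q ^ j * C"] q_pos \<open>C > 0\<close> by (simp add: mult.assoc)
  qed
  show ?thesis
  proof (rule order_tendstoI)
    fix e :: real assume "0 < e"
    have "(\<lambda>j. q ^ j * C) \<longlonglongrightarrow> 0 * C"
      using q by (intro tendsto_intros LIMSEQ_power_zero) auto
    then have "\<forall>\<^sub>F j in sequentially. q ^ j * C < e"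
      using \<open>0 < e\<close> by (intro order_tendstoD(2)[of _ "0 * C"]) auto
    then obtain j where "q ^ j * C < e" by (auto simp: eventually_sequentially)
    with iter[of j] show "\<forall>\<^sub>F n in sequentially. a n < e"
      by (auto elim: eventually_mono)
  next
    fix e :: real assume "e < 0"
    then show "\<forall>\<^sub>F n in sequentially. e < a n" using nonneg by (simp add: less_le_trans)
  qed
qed

text \<open>
  Between the consecutive squares \<open>k\<^sup>2\<close> and \<open>(k + 1)\<^sup>2\<close> the partial sums change by at most
  \<open>2 * k * B\<close>, which is negligible against \<open>k\<^sup>2\<close>.
\<close>

lemma average_tendsto_zero_if_along_squares:
  fixes D :: "nat \<Rightarrow> real"
  assumes bound: "\<And>k. \<bar>D k\<bar> \<le> B"
    and squares: "(\<lambda>k. (\<Sum>j<k\<^sup>2. D j) / real (k\<^sup>2)) \<longlonglongrightarrow> 0"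
  shows "(\<lambda>n. (\<Sum>j<n. D j) / n) \<longlonglongrightarrow> 0"
proof -
  define S where "S n = (\<Sum>j<n. D j)" for n
  \<comment> \<open>\<open>n\<close> is compared with the largest square that does not exceed it.\<close>
  define r where "r = floor_sqrt"
  have r_lim: "filterlim r sequentially sequentially"
    unfolding filterlim_at_top eventually_sequentially r_def
    by (meson le_floor_sqrtI)
  have B: "0 \<le> B" using bound[of 0] by linarith
  define g where "g k = \<bar>S (k\<^sup>2) / real (k\<^sup>2)\<bar> + 2 * B / k" for k :: nat
  have "g \<longlonglongrightarrow> \<bar>0\<bar> + 0"
    unfolding g_def S_def by (intro tendsto_intros squares lim_const_over_n)
  then have g_lim: "(\<lambda>n. g (r n)) \<longlonglongrightarrow> 0"
    using filterlim_compose[OF _ r_lim, of g "nhds 0"] by simp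
  have "\<bar>S n / n\<bar> \<le> g (r n)" if n: "n \<ge> 1" for n
  proof -
    define k where "k = r n"
    have k1: "k\<^sup>2 \<le> n" unfolding k_def r_def by simp
    have k2: "n \<le> k\<^sup>2 + 2 * k"
      using Suc_floor_sqrt_power2_gt[of n] unfolding k_def r_def by (simp add: power2_eq_square)
    have k0: "k \<ge> 1" using n unfolding k_def r_def by (simp add: Suc_le_eq)
    have "S n = S (k\<^sup>2) + (\<Sum>j=k\<^sup>2..<n. D j)"
      unfolding S_def using k1 sum.atLeastLessThan_concat[of 0 "k\<^sup>2" n D] by (simp add: lessThan_atLeast0)
    moreover have "\<bar>\<Sum>j=k\<^sup>2..<n. D j\<bar> \<le> real (n - k\<^sup>2) * B"
      using sum_bounded_above[of "{k\<^sup>2..<n}" "\<lambda>j. \<bar>D j\<bar>" B] bound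
      by (intro order_trans[OF sum_abs]) simp
    moreover have "real (n - k\<^sup>2) * B \<le> real (2 * k) * B"
      using k2 B by (intro mult_right_mono) auto
    ultimately have S: "\<bar>S n\<bar> \<le> \<bar>S (k\<^sup>2)\<bar> + 2 * k * B" by simp
    have "\<bar>S n / n\<bar> \<le> (\<bar>S (k\<^sup>2)\<bar> + 2 * k * B) / n"
      using S by (simp add: divide_right_mono)
    also have "\<dots> \<le> (\<bar>S (k\<^sup>2)\<bar> + 2 * k * B) / real (k\<^sup>2)"
      using k1 k0 B n by (intro divide_left_mono mult_pos_pos) (auto simp del: of_nat_power)
    also have "\<dots> = g k" using k0 by (simp add: g_def field_simps power2_eq_square)
    finally show ?thesis unfolding k_def .
  qed
  then have "\<forall>\<^sub>F n in sequentially. norm (S n / n) \<le> g (r n)"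
    by (auto simp: eventually_sequentially)
  then show ?thesis
    unfolding S_def by (rule Lim_null_comparison[OF _ g_lim])
qed

section \<open>A strong law for bounded orthogonal variables\<close>

lemma (in prob_space) second_moment_orthogonal_sum_le:
  fixes D :: "nat \<Rightarrow> 'a \<Rightarrow> real"
  assumes meas [measurable]: "\<And>k. D k \<in> borel_measurable M"
    and bound: "\<And>k \<omega>. \<omega> \<in> space M \<Longrightarrow> \<bar>D k \<omega>\<bar> \<le> B"
    and orth: "\<And>j k. j < k \<Longrightarrow> expectation (\<lambda>\<omega>. D j \<omega> * D k \<omega>) = 0"
  shows "integrable M (\<lambda>\<omega>. (\<Sum>k<n. D k \<omega>)\<^sup>2) \<and>
         expectation (\<lambda>\<omega>. (\<Sum>k<n. D k \<omega>)\<^sup>2) \<le> real n * B\<^sup>2"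
proof (induction n)
  case 0
  then show ?case by simp
next
  case (Suc n)
  define S where "S \<omega> = (\<Sum>k<n. D k \<omega>)" for \<omega>
  have DD: "integrable M (\<lambda>\<omega>. D j \<omega> * D k \<omega>)" for j k
    using bound by (intro integrable_const_bound[where B="B * B"])
      (auto intro!: AE_I2 mult_mono' simp: abs_mult)
  have SD: "integrable M (\<lambda>\<omega>. S \<omega> * D n \<omega>)"
    unfolding S_def sum_distrib_right by (intro Bochner_Integration.integrable_sum DD)
  have "expectation (\<lambda>\<omega>. S \<omega> * D n \<omega>) = (\<Sum>k<n. expectation (\<lambda>\<omega>. D k \<omega> * D n \<omega>))"
    unfolding S_def sum_distrib_right by (intro Bochner_Integration.integral_sum DD)
  then have zero: "expectation (\<lambda>\<omega>. S \<omega> * D n \<omega>) = 0" by (simp add: orth)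
  have "expectation (\<lambda>\<omega>. D n \<omega> * D n \<omega>) \<le> expectation (\<lambda>\<omega>. B\<^sup>2)"
  proof (intro integral_mono DD)
    fix \<omega> assume "\<omega> \<in> space M"
    then have "\<bar>D n \<omega>\<bar>\<^sup>2 \<le> B\<^sup>2" using bound by (intro power_mono) auto
    then show "D n \<omega> * D n \<omega> \<le> B\<^sup>2" by (simp add: power2_eq_square)
  qed auto
  then have DDn: "expectation (\<lambda>\<omega>. D n \<omega> * D n \<omega>) \<le> B\<^sup>2" by (simp add: prob_space)
  have S2: "integrable M (\<lambda>\<omega>. (S \<omega>)\<^sup>2)" using Suc.IH unfolding S_def by simp
  have eq: "(\<Sum>k<Suc n. D k \<omega>)\<^sup>2 = (S \<omega>)\<^sup>2 + 2 * (S \<omega> * D n \<omega>) + D n \<omega> * D n \<omega>" for \<omega>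
    by (simp add: S_def power2_eq_square algebra_simps)
  have "expectation (\<lambda>\<omega>. (S \<omega>)\<^sup>2 + 2 * (S \<omega> * D n \<omega>) + D n \<omega> * D n \<omega>)
      = expectation (\<lambda>\<omega>. (S \<omega>)\<^sup>2) + 2 * expectation (\<lambda>\<omega>. S \<omega> * D n \<omega>)
        + expectation (\<lambda>\<omega>. D n \<omega> * D n \<omega>)"
    using S2 SD DD by simp
  moreover have "expectation (\<lambda>\<omega>. (S \<omega>)\<^sup>2) \<le> real n * B\<^sup>2" using Suc.IH unfolding S_def by simp
  ultimately show ?case
    unfolding eq using S2 SD DD DDn zero by (simp add: distrib_right)
qed

text \<open>
  The average over \<open>n\<close> terms has second moment \<open>O(1 / n)\<close>. This is summable along the squares, so the
  squared averages have an almost surely finite sum along them and tend to \<open>0\<close> there; boundedness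
  fills the gaps between the squares.
\<close>

lemma (in prob_space) strong_law_bounded_orthogonal:
  fixes D :: "nat \<Rightarrow> 'a \<Rightarrow> real"
  assumes meas [measurable]: "\<And>k. D k \<in> borel_measurable M"
    and bound: "\<And>k \<omega>. \<omega> \<in> space M \<Longrightarrow> \<bar>D k \<omega>\<bar> \<le> B"
    and orth: "\<And>j k. j < k \<Longrightarrow> expectation (\<lambda>\<omega>. D j \<omega> * D k \<omega>) = 0"
  shows "AE \<omega> in M. (\<lambda>n. (\<Sum>k<n. D k \<omega>) / n) \<longlonglongrightarrow> 0"
proof -
  define f where "f k \<omega> = ((\<Sum>j<k\<^sup>2. D j \<omega>) / real (k\<^sup>2))\<^sup>2" for k \<omega>
  have f_meas [measurable]: "f k \<in> borel_measurable M" for k unfolding f_def by measurable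
  have f_le: "(\<integral>\<^sup>+\<omega>. f k \<omega> \<partial>M) \<le> ennreal (B\<^sup>2 * (1 / real k ^ 2))" for k
  proof -
    note moment = second_moment_orthogonal_sum_le[of D B "k\<^sup>2", OF meas bound orth]
    have "integrable M (f k)"
      unfolding f_def power_divide by (intro integrable_divide_zero) (use moment in simp)
    then have "(\<integral>\<^sup>+\<omega>. f k \<omega> \<partial>M) = ennreal (expectation (f k))"
      by (rule nn_integral_eq_integral) (simp add: f_def)
    also have "expectation (f k) = expectation (\<lambda>\<omega>. (\<Sum>j<k\<^sup>2. D j \<omega>)\<^sup>2) / (real (k\<^sup>2))\<^sup>2"
      unfolding f_def power_divide by simp
    also have "\<dots> \<le> real (k\<^sup>2) * B\<^sup>2 / (real (k\<^sup>2))\<^sup>2"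
      using moment by (intro divide_right_mono) auto
    also have "\<dots> = B\<^sup>2 * (1 / real k ^ 2)"
      by (cases "k = 0") (simp_all add: power2_eq_square)
    finally show ?thesis by (simp add: ennreal_leI)
  qed
  have summ: "summable (\<lambda>k. B\<^sup>2 * (1 / real k ^ 2))"
    using inverse_power_summable[of 2, where 'a=real] by (intro summable_mult) (simp add: inverse_eq_divide)
  have "(\<integral>\<^sup>+\<omega>. (\<Sum>k. ennreal (f k \<omega>)) \<partial>M) = (\<Sum>k. \<integral>\<^sup>+\<omega>. ennreal (f k \<omega>) \<partial>M)"
    by (rule nn_integral_suminf) measurable
  also have "\<dots> \<le> (\<Sum>k. ennreal (B\<^sup>2 * (1 / real k ^ 2)))"
    by (intro suminf_le f_le) auto
  also have "\<dots> = ennreal (\<Sum>k. B\<^sup>2 * (1 / real k ^ 2))"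
    by (intro suminf_ennreal2 summ) auto
  also have "\<dots> < \<infinity>" by simp
  finally have "AE \<omega> in M. (\<Sum>k. ennreal (f k \<omega>)) \<noteq> \<infinity>"
    by (intro nn_integral_PInf_AE) auto
  then show ?thesis
    using AE_space
  proof eventually_elim
    case (elim \<omega>)
    have "summable (\<lambda>k. f k \<omega>)"
      using elim(1) by (intro summable_suminf_not_top) (auto simp: f_def)
    then have "(\<lambda>k. sqrt (f k \<omega>)) \<longlonglongrightarrow> sqrt 0"
      by (intro tendsto_real_sqrt summable_LIMSEQ_zero)
    then have "(\<lambda>k. (\<Sum>j<k\<^sup>2. D j \<omega>) / real (k\<^sup>2)) \<longlonglongrightarrow> 0"
      unfolding f_def real_sqrt_abs real_sqrt_zero by (rule tendsto_rabs_zero_cancel)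
    then show ?case
      using bound[OF elim(2)] by (rule average_tendsto_zero_if_along_squares[rotated])
  qed
qed

section \<open>The walks\<close>

context interacting_walks
begin

lemma space_walk_history [simp]: "space (walk_history M W n) = space M"
  unfolding walk_history_def by (rule space_measure_of) auto

lemma sets_walk_history:
  "sets (walk_history M W n) =
     sigma_sets (space M) {W k -` A \<inter> space M | k A. 1 \<le> k \<and> k \<le> n}"
  unfolding walk_history_def by (rule sets_measure_of) auto

lemma subalgebra_walk_history: "subalgebra M (walk_history M W n)"
  unfolding subalgebra_def sets_walk_history
  by (auto intro!: sets.sigma_sets_subset measurable_sets[OF W_measurable])

lemma walk_measurable_history:
  "1 \<le> k \<Longrightarrow> k \<le> n \<Longrightarrow> W k \<in> measurable (walk_history M W n) (count_space UNIV)"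
  by (rule measurableI) (auto simp: sets_walk_history)

lemma occupation_measure_measurable_history:
  assumes "k \<le> n"
  shows "(\<lambda>\<omega>. occupation_measure W k \<omega> $ i $ v) \<in> borel_measurable (walk_history M W n)"
proof (cases "k = 0")
  case False
  have "(\<lambda>\<omega>. of_bool (W l \<omega> $ i = v) :: real) \<in> borel_measurable (walk_history M W n)"
    if "l \<in> {1..k}" for l
    using that assms by (intro measurable_compose[OF walk_measurable_history]) auto
  then have "(\<lambda>\<omega>. (1 + (\<Sum>l=1..k. of_bool (W l \<omega> $ i = v))) / (real CARD('d) + real k))
      \<in> borel_measurable (walk_history M W n)"
    by (intro borel_measurable_divide borel_measurable_add borel_measurable_sum) auto
  then show ?thesis
    using False by (simp add: occupation_measure_def del: sum_of_bool_eq)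
qed (simp add: occupation_measure_def)

lemma transition_map_measurable_history:
  assumes "k \<le> n"
  shows "(\<lambda>\<omega>. transition_map \<alpha> (occupation_measure W k \<omega>) $ i $ v)
           \<in> borel_measurable (walk_history M W n)"
proof -
  note [measurable] = occupation_measure_measurable_history[OF assms]
  show ?thesis unfolding transition_map_softmax softmax_def by measurable
qed

definition noise :: "'m \<Rightarrow> 'd \<Rightarrow> nat \<Rightarrow> 'a \<Rightarrow> real" where
  "noise i v k \<omega> =
     of_bool (W (Suc k) \<omega> $ i = v) - transition_map \<alpha> (occupation_measure W k \<omega>) $ i $ v"

lemma abs_noise_le_1: "\<bar>noise i v k \<omega>\<bar> \<le> 1"
  unfolding noise_def transition_map_softmax
  by (smt (verit) of_bool_def softmax_pos softmax_le_1)

lemma noise_measurable_history: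
  assumes "k < n"
  shows "noise i v k \<in> borel_measurable (walk_history M W n)"
proof -
  have "(\<lambda>\<omega>. of_bool (W (Suc k) \<omega> $ i = v) :: real) \<in> borel_measurable (walk_history M W n)"
    using assms by (intro measurable_compose[OF walk_measurable_history]) auto
  then show ?thesis
    unfolding noise_def using assms
    by (intro borel_measurable_diff transition_map_measurable_history) auto
qed

lemma noise_measurable: "noise i v k \<in> borel_measurable M"
  using measurable_from_subalg[OF subalgebra_walk_history noise_measurable_history[of k "Suc k"]]
  by simp

text \<open>
  \<open>noise i v j\<close> is determined by the history up to time \<open>k\<close>, and given that history
  \<open>noise i v k\<close> has conditional mean \<open>0\<close> by the transition rule.
\<close>

lemma noise_orthogonal:
  assumes "j < k"
  shows "expectation (\<lambda>\<omega>. noise i v j \<omega> * noise i v k \<omega>) = 0"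
proof -
  define F where "F = walk_history M W k"
  define E where "E = {\<omega> \<in> space M. W (k + 1) \<omega> $ i = v}"
  define p where "p \<omega> = transition_map \<alpha> (occupation_measure W k \<omega>) $ i $ v" for \<omega>
  interpret F: finite_measure_subalgebra M F
    by unfold_locales (simp add: F_def subalgebra_walk_history)
  have f: "noise i v j \<in> borel_measurable F"
    unfolding F_def by (rule noise_measurable_history[OF assms])
  note [measurable] = noise_measurable
  have "(\<lambda>\<omega>. W (k + 1) \<omega> $ i) \<in> measurable M (count_space UNIV)"
    by (rule measurable_compose[OF W_measurable]) auto
  then have E [measurable]: "E \<in> sets M"
    unfolding E_def by measurable
  have p [measurable]: "p \<in> borel_measurable M"
    using measurable_from_subalg[OF subalgebra_walk_history transition_map_measurable_history[of k k]]
    unfolding p_def by simp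
  have p01: "0 \<le> p \<omega>" "p \<omega> \<le> 1" for \<omega>
    unfolding p_def transition_map_softmax by (simp_all add: softmax_le_1 less_imp_le[OF softmax_pos])
  have bound: "\<bar>noise i v j \<omega> * q\<bar> \<le> 1" if "\<bar>q\<bar> \<le> 1" for \<omega> q
    using abs_noise_le_1 that by (simp add: abs_mult mult_le_one)
  have intE: "integrable M (\<lambda>\<omega>. noise i v j \<omega> * indicator E \<omega>)"
    by (intro integrable_const_bound[where B=1] AE_I2) (auto intro!: abs_noise_le_1 simp: indicator_def)
  have intp: "integrable M (\<lambda>\<omega>. noise i v j \<omega> * p \<omega>)"
    using p01 by (intro integrable_const_bound[where B=1] AE_I2) (auto intro!: bound)
  have "AE \<omega> in M. real_cond_exp M F (indicator E) \<omega> = p \<omega>"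
    using W_transition[of k i v] unfolding cond_prob_given_def F_def E_def p_def .
  then have "expectation (\<lambda>\<omega>. noise i v j \<omega> * p \<omega>)
      = expectation (\<lambda>\<omega>. noise i v j \<omega> * real_cond_exp M F (indicator E) \<omega>)"
    by (intro integral_cong_AE) auto
  also have "\<dots> = expectation (\<lambda>\<omega>. noise i v j \<omega> * indicator E \<omega>)"
    by (intro F.real_cond_exp_intg(2) intE f) auto
  finally have eq: "expectation (\<lambda>\<omega>. noise i v j \<omega> * p \<omega>)
      = expectation (\<lambda>\<omega>. noise i v j \<omega> * indicator E \<omega>)" .
  have "expectation (\<lambda>\<omega>. noise i v j \<omega> * noise i v k \<omega>)
      = expectation (\<lambda>\<omega>. noise i v j \<omega> * indicator E \<omega> - noise i v j \<omega> * p \<omega>)"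
    by (intro Bochner_Integration.integral_cong)
       (auto simp: noise_def[of i v k] E_def p_def right_diff_distrib)
  also have "\<dots> = 0" using intE intp eq by simp
  finally show ?thesis .
qed

lemma noise_strong_law:
  "AE \<omega> in M. \<forall>i v. (\<lambda>n. (\<Sum>k<n. noise i v k \<omega>) / n) \<longlonglongrightarrow> 0"
  unfolding AE_all_countable
  by (intro allI strong_law_bounded_orthogonal[where B=1] noise_measurable
      abs_noise_le_1 noise_orthogonal)

lemma infnorm_occupation_measure_le_1: "infnorm (occupation_measure W n \<omega>) \<le> 1"
proof (cases "n = 0")
  case False
  have le: "(\<Sum>k=1..n. of_bool (W k \<omega> $ i = v) :: real) \<le> real n" for i v
    using sum_bounded_above[of "{1..n}" "\<lambda>k. of_bool (W k \<omega> $ i = v) :: real" 1] by simp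
  have "1 \<le> real CARD('d)" using zero_less_card_finite[where 'a='d] by linarith
  then have "1 + (\<Sum>k=1..n. of_bool (W k \<omega> $ i = v) :: real) \<le> real CARD('d) + real n" for i v
    using le[of i v] by linarith
  moreover have "0 \<le> (\<Sum>k=1..n. of_bool (W k \<omega> $ i = v) :: real)" for i v
    by (intro sum_nonneg) auto
  ultimately show ?thesis
    using False by (simp add: infnorm_le_iff_components occupation_measure_def abs_divide)
qed (simp add: infnorm_le_iff_components occupation_measure_def)

text \<open>
  Besides the noise, the average carries the contribution of the initial weight \<open>1\<close> of every vertex,
  measured relative to the point \<open>x\<close>: this is the term \<open>1 - d * x\<close>, which vanishes in the limit
  like \<open>1 / n\<close>.
\<close>

definition noise_average :: "real ^ 'd ^ 'm \<Rightarrow> nat \<Rightarrow> 'a \<Rightarrow> real ^ 'd ^ 'm" where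
  "noise_average x n \<omega> =
     (\<chi> i v. (1 - CARD('d) * x $ i $ v + (\<Sum>k<n. noise i v k \<omega>)) / (CARD('d) + real n))"

lemma occupation_measure_decomposition:
  assumes "n \<ge> 1"
  shows "occupation_measure W n \<omega> - x = noise_average x n \<omega> +
    (1 / (CARD('d) + real n)) *\<^sub>R (\<Sum>k<n. transition_map \<alpha> (occupation_measure W k \<omega>) - x)"
proof -
  have "(occupation_measure W n \<omega> - x) $ i $ v = (noise_average x n \<omega> +
    (1 / (CARD('d) + real n)) *\<^sub>R (\<Sum>k<n. transition_map \<alpha> (occupation_measure W k \<omega>) - x)) $ i $ v"
    for i v
  proof -
    define s1 :: real where "s1 = (\<Sum>k<n. of_bool (W (Suc k) \<omega> $ i = v))"
    define s2 where "s2 = (\<Sum>k<n. transition_map \<alpha> (occupation_measure W k \<omega>) $ i $ v)"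
    have "(\<Sum>k=1..n. of_bool (W k \<omega> $ i = v)) = s1"
      unfolding s1_def One_nat_def by (rule sum.atLeast1_atMost_eq)
    then have X: "occupation_measure W n \<omega> $ i $ v = (1 + s1) / (CARD('d) + real n)"
      using assms by (simp add: occupation_measure_def del: sum_of_bool_eq)
    have "(\<Sum>k<n. noise i v k \<omega>) = s1 - s2"
      unfolding s1_def s2_def noise_def by (rule sum_subtractf)
    then have N: "noise_average x n \<omega> $ i $ v
        = (1 - CARD('d) * x $ i $ v + (s1 - s2)) / (CARD('d) + real n)"
      by (simp add: noise_average_def)
    have drift: "(\<Sum>k<n. transition_map \<alpha> (occupation_measure W k \<omega>) - x) $ i $ v = s2 - n * x $ i $ v"
      by (simp only: sum_component vector_minus_component sum_subtractf s2_def) simp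
    define q where "q = CARD('d) + real n"
    have "q > 0" using assms unfolding q_def by linarith
    then have "(1 + s1) / q - x $ i $ v = (1 + s1 - q * x $ i $ v) / q"
      by (simp add: diff_divide_distrib)
    also have "1 + s1 - q * x $ i $ v = (1 - CARD('d) * x $ i $ v + (s1 - s2)) + (s2 - n * x $ i $ v)"
      by (simp add: q_def algebra_simps)
    finally have "(1 + s1) / q - x $ i $ v
        = (1 - CARD('d) * x $ i $ v + (s1 - s2)) / q + 1 / q * (s2 - n * x $ i $ v)"
      by (simp only: add_divide_distrib times_divide_eq_left mult_1)
    then show ?thesis
      unfolding q_def
      by (simp only: vector_add_component vector_minus_component vector_scaleR_component
          real_scaleR_def X N drift)
  qed
  then show ?thesis by (simp add: vec_eq_iff)
qed

lemma infnorm_noise_average_tendsto_zero: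
  assumes "\<And>i v. (\<lambda>n. (\<Sum>k<n. noise i v k \<omega>) / n) \<longlonglongrightarrow> 0"
  shows "(\<lambda>n. infnorm (noise_average x n \<omega>)) \<longlonglongrightarrow> 0"
proof -
  have "(\<lambda>n. noise_average x n \<omega> $ i $ v) \<longlonglongrightarrow> 0" for i v
  proof (rule Lim_null_comparison)
    define C where "C = 1 - CARD('d) * x $ i $ v"
    define S where "S n = (\<Sum>k<n. noise i v k \<omega>)" for n
    have "\<bar>C + S n\<bar> / (CARD('d) + real n) \<le> \<bar>C\<bar> / n + \<bar>S n / n\<bar>" if "n \<ge> 1" for n
    proof -
      have "\<bar>C + S n\<bar> / (CARD('d) + real n) \<le> (\<bar>C\<bar> + \<bar>S n\<bar>) / n"
        using that by (intro frac_le) auto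
      then show ?thesis by (simp add: add_divide_distrib abs_divide)
    qed
    then show "\<forall>\<^sub>F n in sequentially. norm (noise_average x n \<omega> $ i $ v) \<le> \<bar>C\<bar> / n + \<bar>S n / n\<bar>"
      by (auto simp: eventually_sequentially noise_average_def C_def S_def abs_divide)
    have "(\<lambda>n. \<bar>C\<bar> / n + \<bar>S n / n\<bar>) \<longlonglongrightarrow> 0 + \<bar>0\<bar>"
      unfolding S_def by (intro tendsto_intros lim_const_over_n assms)
    then show "(\<lambda>n. \<bar>C\<bar> / n + \<bar>S n / n\<bar>) \<longlonglongrightarrow> 0" by simp
  qed
  then have "(\<lambda>n. noise_average x n \<omega>) \<longlonglongrightarrow> 0"
    by (intro vec_tendstoI) (simp add: zero_vec_def)
  then show ?thesis using tendsto_infnorm infnorm_0 by metis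
qed

text \<open>
  On the almost sure event where the noise averages vanish, the argument is deterministic: by the
  decomposition and the contraction property, the sup distance to \<open>x\<close> is at most a null sequence plus
  \<open>c\<close> times the average of its own past values.
\<close>

lemma occupation_measure_tendsto_fixed_point:
  assumes c: "0 \<le> c" "c < 1"
    and contr: "\<And>y z. infnorm (transition_map \<alpha> y - transition_map \<alpha> z) \<le> c * infnorm (y - z)"
    and x: "transition_map \<alpha> x = x"
  shows "AE \<omega> in M. (\<lambda>n. occupation_measure W n \<omega>) \<longlonglongrightarrow> x"
  using noise_strong_law
proof eventually_elim
  case (elim \<omega>)
  define X where "X n = occupation_measure W n \<omega>" for n
  define a where "a n = infnorm (X n - x)" for n
  have "a \<longlonglongrightarrow> 0"
  proof (rule tendsto_zero_if_le_contracted_average[OF _ _ infnorm_noise_average_tendsto_zero[of \<omega> x] c])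
    show "0 \<le> a n" for n unfolding a_def by (rule infnorm_pos_le)
    show "a n \<le> 1 + infnorm x" for n
      using infnorm_triangle[of "X n" "- x"] infnorm_occupation_measure_le_1[of n \<omega>]
      by (simp add: a_def X_def infnorm_neg)
    show "a n \<le> infnorm (noise_average x n \<omega>) + c * ((\<Sum>k<n. a k) / n)" if n: "n \<ge> 1" for n
    proof -
      define s where "s = (\<Sum>k<n. transition_map \<alpha> (X k) - x)"
      have "infnorm s \<le> (\<Sum>k<n. infnorm (transition_map \<alpha> (X k) - x))"
        unfolding s_def by (rule infnorm_sum_le)
      also have "\<dots> \<le> (\<Sum>k<n. c * a k)"
        using contr[of _ x] by (intro sum_mono) (simp add: a_def x)
      also have "\<dots> = c * (\<Sum>k<n. a k)" by (simp add: sum_distrib_left)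
      finally have s: "infnorm s \<le> c * (\<Sum>k<n. a k)" .
      have "a n \<le> infnorm (noise_average x n \<omega>) + infnorm ((1 / (CARD('d) + real n)) *\<^sub>R s)"
        unfolding a_def X_def occupation_measure_decomposition[OF n] s_def by (rule infnorm_triangle)
      also have "infnorm ((1 / (CARD('d) + real n)) *\<^sub>R s) \<le> c * (\<Sum>k<n. a k) / n"
        unfolding infnorm_mul using n s order_trans[OF infnorm_pos_le s]
        by (auto intro!: frac_le)
      finally show ?thesis by simp
    qed
  qed (use elim in auto)
  then have "(\<lambda>n. sqrt DIM(real ^ 'd ^ 'm) * a n) \<longlonglongrightarrow> 0"
    by (rule tendsto_mult_right_zero)
  then have "(\<lambda>n. X n - x) \<longlonglongrightarrow> 0"
    by (rule Lim_null_comparison[rotated]) (intro always_eventually allI, simp only: a_def norm_le_infnorm)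
  then show ?case unfolding X_def by (simp add: LIM_zero_iff)
qed

end

theorem theorem4:
  fixes \<alpha> :: "'d::finite \<Rightarrow> 'm::finite \<Rightarrow> 'm \<Rightarrow> real"
  assumes "CARD('m) \<ge> 2" and "CARD('d) \<ge> 2"
    and "\<And>v i j. \<alpha> v i j = \<alpha> v j i"
    and "\<And>(v::'d) (i::'m). \<alpha> v i i = 0 \<and> (\<Sum>u\<in>UNIV. \<Sum>j\<in>UNIV - {i}. \<bar>\<alpha> u i j\<bar>) < 4"
  shows "(\<exists>!x. equilibrium_point (vector_field \<alpha>) x) \<and>
    (\<forall>x (M :: 'a measure) W.
       equilibrium_point (vector_field \<alpha>) x \<longrightarrow> interacting_walks M \<alpha> W \<longrightarrow>
       (AE \<omega> in M. (\<lambda>n. occupation_measure W n \<omega>) \<longlonglongrightarrow> x))"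
proof -
  \<comment> \<open>The diagonal terms vanish, so they may be added to the sum in the hypothesis.\<close>
  have "(\<Sum>u\<in>UNIV. \<Sum>j\<in>UNIV. \<bar>\<alpha> u i j\<bar>) < 4" for i
  proof -
    have "(\<Sum>j\<in>UNIV. \<bar>\<alpha> u i j\<bar>) = (\<Sum>j\<in>UNIV - {i}. \<bar>\<alpha> u i j\<bar>)" for u
      using assms(4)[of u i] by (simp add: sum.remove[of UNIV i])
    then show ?thesis using assms(4) by simp
  qed
  then obtain c where c: "0 \<le> c" "c < 1"
    and contr: "\<And>y z. infnorm (transition_map \<alpha> y - transition_map \<alpha> z) \<le> c * infnorm (y - z)"
    using transition_map_contraction[of \<alpha>] by blast
  have "y = z" if "transition_map \<alpha> y = y" "transition_map \<alpha> z = z" for y z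
  proof -
    have "(1 - c) * infnorm (y - z) \<le> 0" using contr[of y z] that by (simp add: algebra_simps)
    then have "infnorm (y - z) \<le> 0" using c by (simp add: mult_le_0_iff)
    then show ?thesis using infnorm_pos_lt[of "y - z"] by auto
  qed
  then have "\<exists>!x. equilibrium_point (vector_field \<alpha>) x"
    unfolding equilibrium_point_vector_field_iff using transition_map_has_fixed_point[of \<alpha>] by blast
  moreover have "AE \<omega> in M. (\<lambda>n. occupation_measure W n \<omega>) \<longlonglongrightarrow> x"
    if "equilibrium_point (vector_field \<alpha>) x" "interacting_walks M \<alpha> W" for x W and M :: "'a measure"
    using interacting_walks.occupation_measure_tendsto_fixed_point[OF that(2) c contr] that(1)
    by (simp add: equilibrium_point_vector_field_iff)
  ultimately show ?thesis by blast
qed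

end
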